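(* The asymptotic density of the set of $n$ for which $R(n)=R(n+1)$ exists and equals $\frac1{\varphi^4}+\frac1{\varphi^5}=\frac1{\varphi^3}$; that is, \[ \lim_{N\to\infty}\frac1N\,\#\{0\le n<N: R(n)=R(n+1)\}=\frac1{\varphi^4}+\frac1{\varphi^5}=\frac{1}{\varphi^3}. \]
   Context: $\varphi=\frac{1+\sqrt5}{2}$. Fibonacci numbers: $F_1=F_2=1$, $F_{m+2}=F_{m+1}+F_m$. For an integer $n\ge0$, $R(n)$ is the number of ways of writing $n$ as a sum of distinct Fibonacci numbers (i.e. the number of finite subsets $S\subset\{2,3,4,\dots\}$ with $\sum_{i\in S}F_i=n$; $R(0)=1$). *)

theory Defs
  imports "HOL-Analysis.Analysis" "HOL-Number_Theory.Fib"
begin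

definition golden_ratio :: real  (\<open>\<phi>\<close>)
  where "\<phi> = (1 + sqrt 5) / 2"

text \<open>
  Representations are sets of indices, not sets of values. As indices start at 2, the value
  \<open>1 = fib 1 = fib 2\<close> is available only once.
\<close>

definition fib_representations :: "nat \<Rightarrow> nat set set"
  where "fib_representations n = {S. finite S \<and> S \<subseteq> {2..} \<and> (\<Sum>i\<in>S. fib i) = n}"

definition R :: "nat \<Rightarrow> nat"
  where "R n = card (fib_representations n)"

text \<open>
  The set counted by \<open>R\<close> is finite, so \<^const>\<open>card\<close> never takes its default value 0 on an
  infinite set.
\<close>

lemma less_fib_add_2: "n < fib (n + 2)"
proof (induction n)
  case 0
  show ?case by simp
next
  case (Suc n)
  have "fib (Suc n + 2) = fib (n + 2) + fib (n + 1)"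
    using fib_plus_2[of "n + 1"] by (simp add: numeral_eq_Suc)
  moreover have "fib (n + 1) > 0"
    by (rule fib_neq_0_nat) simp
  ultimately show ?case using Suc.IH by linarith
qed

lemma finite_fib_representations: "finite (fib_representations n)"
proof (rule finite_subset)
  show "fib_representations n \<subseteq> Pow {..n + 2}"
  proof (intro subsetI PowI)
    fix S i assume "S \<in> fib_representations n" and i: "i \<in> S"
    then have S: "finite S" "S \<subseteq> {2..}" "(\<Sum>i\<in>S. fib i) = n"
      by (auto simp: fib_representations_def)
    have "fib i \<le> n"
      using S i member_le_sum[of i S fib] by auto
    moreover have "i - 2 < fib i"
    proof -
      have "i - 2 + 2 = i" using S(2) i by auto
      then show ?thesis using less_fib_add_2[of "i - 2"] by metis
    qed
    ultimately show "i \<in> {..n + 2}" by simp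
  qed
qed simp

lemma R_0: "R 0 = 1"
proof -
  have "fib_representations 0 = {{}}"
  proof (intro equalityI subsetI)
    fix S assume "S \<in> fib_representations 0"
    then have "finite S" "S \<subseteq> {2..}" and z: "\<forall>i\<in>S. fib i = 0"
      by (auto simp: fib_representations_def)
    then have "i \<notin> S" for i
      using fib_neq_0_nat[of i] by force
    then show "S \<in> {{}}" by auto
  qed (simp add: fib_representations_def)
  then show ?thesis by (simp add: R_def)
qed

end

theory Submission
  imports Defs "HOL-Real_Asymp.Real_Asymp"
begin

text \<open>
  Write \<open>F\<close> for the Fibonacci numbers and \<open>d n = R (n + 1) - R n\<close>
  (\<open>R_diff\<close> below); the zeros of \<open>d\<close> are to be
  counted. The idea is that these zeros are almost unaffected by prefixing a large Fibonacci
  number: for \<open>2 \<le> k < F\<^sub>j\<close> and \<open>j \<ge> 5\<close> one has \<open>d (F\<^bsub>j+1\<^esub> + k) = 0\<close> iff \<open>d k = 0\<close>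
  (lemma \<open>R_diff_fib_add_eq_0_iff\<close>).

  The source of this self-similarity is a reflection. A representation of
  \<open>F\<^bsub>j+1\<^esub> + k\<close> with \<open>k < F\<^sub>j\<close> either uses \<open>F\<^bsub>j+1\<^esub>\<close>, leaving a representation of \<open>k\<close>, or it is
  a subset of the indices \<open>2, \<dots>, j\<close>, whose complement represents
  \<open>l = F\<^sub>j - 2 - k\<close>. Hence \<open>R (F\<^bsub>j+1\<^esub> + k) = R k + R l\<close> (lemma \<open>R_reflection\<close>), and
  \<open>d (F\<^bsub>j+1\<^esub> + k) = d k - d l\<close> when \<open>k + l + 3 = F\<^sub>j\<close>. This difference could vanish by
  accidental cancellation; that it does not is the crux of the proof: the numbers
  \<open>d k\<close> and \<open>d l\<close> have opposite signs, or both vanish, as soon as \<open>k, l \<ge> 2\<close>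
  (lemma \<open>R_diff_antisymmetric\<close>). This follows by induction from the same formula.

  The positions \<open>k = 0\<close> and \<open>k = 1\<close> are both zeros of \<open>d\<close>, but exactly one of the positions
  \<open>F\<^sub>m\<close> and \<open>F\<^sub>m + 1\<close> is, for \<open>m \<ge> 5\<close>. So for the number \<open>A N\<close> of zeros below \<open>N\<close>, and for
  \<open>2 \<le> N \<le> F\<^sub>j\<close> with \<open>j \<ge> 5\<close>,
  \<open>A (F\<^bsub>j+1\<^esub> + N) = A (F\<^bsub>j+1\<^esub>) + A N - 1\<close>. In particular \<open>A (F\<^sub>m) - 1\<close> satisfies the
  Fibonacci recursion, which gives \<open>A (F\<^sub>m) = F\<^bsub>m-3\<^esub> + 1\<close> for \<open>m \<ge> 5\<close> and thus the density
  \<open>1 / \<phi>\<^sup>3\<close> along the Fibonacci numbers. For arbitrary \<open>N\<close>, stripping the largest Fibonacci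
  number changes the error \<open>A N - N / \<phi>\<^sup>3\<close> by a bounded amount and at least halves \<open>N\<close>,
  so the error is \<open>O(log N)\<close> (lemma \<open>discrepancy_bound\<close>).
\<close>

section \<open>The reflection recursion for the number of representations\<close>

lemma sum_fib_interval:
  assumes "j \<ge> 1"
  shows "(\<Sum>i=2..j. fib i) + 2 = fib (j + 2)"
  using assms
proof (induction j rule: dec_induct)
  case base
  show ?case by (simp add: numeral_eq_Suc)
next
  case (step n)
  then have "(\<Sum>i=2..Suc n. fib i) = (\<Sum>i=2..n. fib i) + fib (Suc n)"
    by simp
  then show ?case using step by simp
qed

lemma fib_representations_bounded:
  assumes "S \<in> fib_representations n" "n < fib (Suc j)"
  shows "S \<subseteq> {2..j}"
proof
  fix i assume i: "i \<in> S"
  have S: "finite S" "S \<subseteq> {2..}" "sum fib S = n"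
    using assms(1) by (auto simp: fib_representations_def)
  have "fib i \<le> n"
    using S i member_le_sum[of i S fib] by auto
  then have "\<not> Suc j \<le> i"
    using fib_mono[of "Suc j" i] assms(2) by linarith
  then show "i \<in> {2..j}" using S i by auto
qed

text \<open>
  The first summand counts the representations that use \<open>fib (Suc j)\<close>, the second those that do
  not. Larger Fibonacci numbers cannot occur, since \<open>fib (Suc j) + k < fib (j + 2)\<close>.
\<close>

lemma R_fib_add:
  assumes k: "k < fib j"
  shows "R (fib (Suc j) + k) = R k + card {S. S \<subseteq> {2..j} \<and> sum fib S = fib (Suc j) + k}"
proof -
  have j: "j \<ge> 1" using k by (cases j) auto
  have kj: "k < fib (Suc j)" using k fib_mono[of j "Suc j"] by simp
  have lt: "fib (Suc j) + k < fib (Suc (Suc j))" using k by simp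
  let ?C = "{S. S \<subseteq> {2..j} \<and> sum fib S = fib (Suc j) + k}"
  have eq: "fib_representations (fib (Suc j) + k) = insert (Suc j) ` fib_representations k \<union> ?C"
  proof (intro equalityI subsetI)
    fix S assume S: "S \<in> fib_representations (fib (Suc j) + k)"
    then have fS: "finite S" "sum fib S = fib (Suc j) + k" "S \<subseteq> {2..}"
      by (auto simp: fib_representations_def)
    have sub: "S \<subseteq> {2..Suc j}" by (rule fib_representations_bounded[OF S lt])
    show "S \<in> insert (Suc j) ` fib_representations k \<union> ?C"
    proof (cases "Suc j \<in> S")
      case True
      have "sum fib (S - {Suc j}) = k"
        using fS True by (simp add: sum_diff1_nat)
      then have "S - {Suc j} \<in> fib_representations k"
        using fS by (auto simp: fib_representations_def)
      moreover have "S = insert (Suc j) (S - {Suc j})" using True by auto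
      ultimately show ?thesis by blast
    next
      case False
      then have "S \<subseteq> {2..j}" using sub by (force simp: le_Suc_eq)
      then show ?thesis using fS by auto
    qed
  next
    fix S assume "S \<in> insert (Suc j) ` fib_representations k \<union> ?C"
    then show "S \<in> fib_representations (fib (Suc j) + k)"
    proof
      assume "S \<in> insert (Suc j) ` fib_representations k"
      then obtain T where T: "T \<in> fib_representations k" "S = insert (Suc j) T" by auto
      have "Suc j \<notin> T" using fib_representations_bounded[OF T(1) kj] by auto
      then show ?thesis using T j by (auto simp: fib_representations_def)
    next
      assume "S \<in> ?C"
      then show ?thesis by (auto simp: fib_representations_def intro: finite_subset)
    qed
  qed
  have notin: "Suc j \<notin> T" if "T \<in> fib_representations k" for T
    using fib_representations_bounded[OF that kj] by auto
  have "inj_on (insert (Suc j)) (fib_representations k)"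
    using notin by (auto intro!: inj_onI simp: insert_ident)
  then have "card (insert (Suc j) ` fib_representations k) = R k"
    by (simp add: card_image R_def)
  moreover have "insert (Suc j) ` fib_representations k \<inter> ?C = {}" by auto
  moreover have "finite ?C" by (rule finite_subset[of _ "Pow {2..j}"]) auto
  ultimately show ?thesis
    unfolding R_def[of "fib (Suc j) + k"] eq
    by (simp add: card_Un_disjoint finite_fib_representations)
qed

text \<open>
  The Fibonacci numbers with indices \<open>2, \<dots>, j\<close> sum to \<open>fib (j + 2) - 2 = (fib (Suc j) + k) + l\<close>,
  so complementation in \<open>{2..j}\<close> turns the representations of \<open>fib (Suc j) + k\<close> without
  \<open>fib (Suc j)\<close> into the representations of \<open>l\<close>. The additive hypothesis expresses
  \<open>l = fib j - 2 - k\<close> without truncated subtraction and displays the symmetry in \<open>k\<close> and \<open>l\<close>.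
\<close>

lemma R_reflection:
  assumes kl: "k + l + 2 = fib j"
  shows "R (fib (Suc j) + k) = R k + R l"
proof -
  have j: "j \<ge> 1" using kl by (cases j) auto
  have l: "l < fib (Suc j)" using kl fib_mono[of j "Suc j"] by simp
  have total: "(\<Sum>i=2..j. fib i) = fib (Suc j) + k + l"
    using sum_fib_interval[OF j] kl by simp
  have compl: "sum fib S + sum fib ({2..j} - S) = fib (Suc j) + k + l" if "S \<subseteq> {2..j}" for S
    using sum.subset_diff[OF that, of fib] total by simp
  have "bij_betw (\<lambda>S. {2..j} - S)
      {S. S \<subseteq> {2..j} \<and> sum fib S = fib (Suc j) + k} (fib_representations l)"
  proof (rule bij_betwI[where g = "\<lambda>S. {2..j} - S"])
    show "(\<lambda>S. {2..j} - S) \<in> {S. S \<subseteq> {2..j} \<and> sum fib S = fib (Suc j) + k} \<rightarrow> fib_representations l"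
    proof
      fix S assume S: "S \<in> {S. S \<subseteq> {2..j} \<and> sum fib S = fib (Suc j) + k}"
      then have "sum fib ({2..j} - S) = l" using compl[of S] by simp
      then show "{2..j} - S \<in> fib_representations l" by (auto simp: fib_representations_def)
    qed
    show "(\<lambda>S. {2..j} - S) \<in> fib_representations l \<rightarrow> {S. S \<subseteq> {2..j} \<and> sum fib S = fib (Suc j) + k}"
    proof
      fix T assume T: "T \<in> fib_representations l"
      have "T \<subseteq> {2..j}" by (rule fib_representations_bounded[OF T l])
      moreover have "sum fib T = l" using T by (simp add: fib_representations_def)
      ultimately show "{2..j} - T \<in> {S. S \<subseteq> {2..j} \<and> sum fib S = fib (Suc j) + k}"
        using compl[of T] by auto
    qed
    show "{2..j} - ({2..j} - S) = S" if "S \<in> {S. S \<subseteq> {2..j} \<and> sum fib S = fib (Suc j) + k}" for S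
      using that by auto
    show "{2..j} - ({2..j} - T) = T" if "T \<in> fib_representations l" for T
      using fib_representations_bounded[OF that l] by auto
  qed
  then have "card {S. S \<subseteq> {2..j} \<and> sum fib S = fib (Suc j) + k} = R l"
    unfolding R_def by (rule bij_betw_same_card)
  then show ?thesis using R_fib_add[of k j] kl by simp
qed

text \<open>
  Such an \<open>n\<close> is the boundary case that \<open>R_reflection\<close> omits: here the indices
  \<open>2, \<dots>, i\<close> have too small a sum, so the largest Fibonacci number not exceeding \<open>n\<close> is forced, and
  removing it leads to a number of the same form.
\<close>

lemma R_pred_fib: "Suc n = fib j \<Longrightarrow> R n = 1"
proof (induction j arbitrary: n rule: less_induct)
  case (less j)
  show ?case
  proof (cases "j \<le> 2")
    case True
    then have "n = 0" using less.prems by (auto simp: le_Suc_eq numeral_eq_Suc)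
    then show ?thesis by (simp add: R_0)
  next
    case False
    then obtain i where i: "j = Suc (Suc i)" "i \<ge> 1"
      using that[of "j - 2"] by simp
    obtain k where k: "Suc k = fib i" using fib_neq_0_nat[of i] i(2) by (cases "fib i") auto
    have n: "n = fib (Suc i) + k" using less.prems k i by simp
    have small: "sum fib S < n" if "S \<subseteq> {2..i}" for S
    proof -
      have "sum fib S \<le> (\<Sum>t=2..i. fib t)" by (rule sum_mono2) (use that in auto)
      then show ?thesis using sum_fib_interval[OF i(2)] less.prems i by simp
    qed
    have empty: "{S. S \<subseteq> {2..i} \<and> sum fib S = fib (Suc i) + k} = {}"
      unfolding n[symmetric] using small less_irrefl by blast
    have "k < fib i" using k by simp
    then have "R n = R k" using R_fib_add[of k i] unfolding empty n by simp
    then show ?thesis using less.IH[OF _ k] i by simp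
  qed
qed

text \<open>
  The bound 2 makes the difference at \<open>fib j - 2\<close> strictly negative, as \<open>R (fib j - 1) = 1\<close>. It
  comes from unfolding \<open>fib j - 2 = fib (j - 1) + (fib (j - 2) - 2)\<close>, whose reflection is 0.
\<close>

lemma R_fib_minus_2:
  assumes "n + 2 = fib j"
  shows "R n \<ge> 1" and "j \<ge> 5 \<Longrightarrow> R n \<ge> 2"
proof -
  have "R n \<ge> 1 \<and> (j \<ge> 5 \<longrightarrow> R n \<ge> 2)" using assms
  proof (induction j arbitrary: n rule: less_induct)
    case (less j)
    show ?case
    proof (cases "j \<ge> 5")
      case True
      then obtain i where i: "j = Suc (Suc i)" "i \<ge> 3"
        using that[of "j - 2"] by simp
      have "fib i \<ge> 2" using fib_mono[OF i(2)] by (simp add: numeral_eq_Suc)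
      then obtain p where p: "p + 2 = fib i" using that[of "fib i - 2"] by simp
      have n: "n = fib (Suc i) + p" using less.prems p i by simp
      have "R n = R p + R 0" unfolding n by (rule R_reflection) (use p in simp)
      then show ?thesis using less.IH[OF _ p] i by (simp add: R_0)
    next
      case False
      then have "j \<in> {0,1,2,3,4}" by auto
      then have "Suc n = fib 3 \<or> n = 0" using less.prems by (auto simp: numeral_eq_Suc)
      then show ?thesis using False R_pred_fib R_0 by fastforce
    qed
  qed
  then show "R n \<ge> 1" and "j \<ge> 5 \<Longrightarrow> R n \<ge> 2" by auto
qed

section \<open>The sign of consecutive differences\<close>

definition R_diff :: "nat \<Rightarrow> int"
  where "R_diff n = int (R (n + 1)) - int (R n)"

lemma R_diff_eq_0_iff: "R_diff n = 0 \<longleftrightarrow> R n = R (n + 1)"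
  by (auto simp: R_diff_def)

lemma R_diff_reflection:
  assumes "k + l + 3 = fib j"
  shows "R_diff (fib (Suc j) + k) = R_diff k - R_diff l"
proof -
  have "R (fib (Suc j) + k) = R k + R (l + 1)"
    by (rule R_reflection) (use assms in simp)
  moreover have "R (fib (Suc j) + (k + 1)) = R (k + 1) + R l"
    by (rule R_reflection) (use assms in simp)
  ultimately show ?thesis by (simp add: R_diff_def)
qed

lemma fib_small: "fib 3 = 2" "fib 4 = 3" "fib 5 = 5" "fib 6 = 8" "fib 7 = 13"
  by (simp_all add: numeral_eq_Suc)

lemma R_small: "R 1 = 1" "R 2 = 1" "R 3 = 2" "R 4 = 1" "R 5 = 2" "R 6 = 2" "R 7 = 1" "R 8 = 3"
proof -
  show "R 1 = 1" "R 2 = 1" "R 4 = 1" "R 7 = 1"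
    using R_pred_fib[of 1 3] R_pred_fib[of 2 4] R_pred_fib[of 4 5] R_pred_fib[of 7 6]
    by (simp_all add: fib_small)
  show 3: "R 3 = 2"
    using R_reflection[of 0 0 3] by (simp add: fib_small R_0)
  show "R 5 = 2" "R 6 = 2"
    using R_reflection[of 0 1 4] R_reflection[of 1 0 4] \<open>R 1 = 1\<close> by (simp_all add: fib_small R_0)
  show "R 8 = 3"
    using R_reflection[of 0 3 5] 3 by (simp add: fib_small R_0)
qed

lemma R_diff_small:
  "R_diff 0 = 0" "R_diff (Suc 0) = 0" "R_diff 2 = 1" "R_diff 3 = -1"
  "R_diff 4 = 1" "R_diff 5 = 0" "R_diff 6 = -1" "R_diff 7 = 2"
  using R_0 R_small by (simp_all add: R_diff_def eval_nat_numeral)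

lemma R_diff_less_2: "n < 2 \<Longrightarrow> R_diff n = 0"
  by (auto simp: numeral_2_eq_2 less_Suc_eq R_diff_small)

text \<open>
  This and the next lemma fix the sign of the difference at the two places just below a Fibonacci
  number, where \<open>R_diff_reflection\<close> does not apply because the partner \<open>l\<close> would be negative.
\<close>

lemma R_diff_pred_fib:
  assumes "Suc n = fib j" "j \<ge> 4"
  shows "R_diff n > 0"
proof -
  obtain i where i: "j = Suc i" "i \<ge> 3" using assms(2) by (cases j) auto
  have "fib i \<ge> 2" using fib_mono[OF i(2)] by (simp add: fib_small)
  then obtain l where l: "l + 2 = fib i" using that[of "fib i - 2"] by simp
  have "R (fib (Suc i) + 0) = R 0 + R l" by (rule R_reflection) (use l in simp)
  then have "R (n + 1) \<ge> 2" using R_fib_minus_2(1)[OF l] assms i by (simp add: R_0)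
  then show ?thesis using R_pred_fib[OF assms(1)] by (simp add: R_diff_def)
qed

lemma R_diff_fib_minus_2:
  assumes "n + 2 = fib j" "j \<ge> 5"
  shows "R_diff n < 0"
  using R_pred_fib[of "n + 1" j] R_fib_minus_2(2)[OF assms] assms(1) by (simp add: R_diff_def)

text \<open>
  Let \<open>l\<close> be the larger of the two numbers and \<open>j = i + 2\<close>. If \<open>l = fib (i + 1) + p\<close>, then
  \<open>p + k + 3 = fib i\<close>, so the induction hypothesis makes \<open>d p\<close> and \<open>- d k\<close> agree in sign
  (or \<open>p < 2\<close> and \<open>d p = 0\<close>), and \<open>d l = d p - d k\<close> has the sign of \<open>- d k\<close>. If both numbers lie between \<open>fib i\<close> and \<open>fib (i + 1)\<close>,
  then they are mirror images of each other in the range of \<open>R_diff_reflection\<close>, and their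
  differences are exactly opposite. The remaining case places both numbers at distance
  one or two below a Fibonacci number.

  The bounds \<open>k, l \<ge> 2\<close> are necessary: \<open>d\<close> vanishes at 0 and 1, but for \<open>k = 0\<close> it
  may take either the value 0 or a nonzero value at \<open>fib j - 3\<close>, depending on the parity of \<open>j\<close>.
\<close>

lemma R_diff_antisymmetric:
  assumes "k + l + 3 = fib j" "k \<ge> 2" "l \<ge> 2"
  shows "sgn (R_diff k) = - sgn (R_diff l)"
  using assms
proof (induction j arbitrary: k l rule: less_induct)
  case (less j)
  show ?case
  proof (cases "j \<le> 6")
    case True
    have "fib j \<le> 8" using fib_mono[OF True] by (simp add: fib_small)
    moreover have "j = 6 \<or> fib j \<le> 5"
      using True fib_mono[of j 5] by (cases "j = 6") (auto simp: fib_small)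
    ultimately have "k + l = 5" using less.prems by (auto simp: fib_small)
    then have "k = 2 \<and> l = 3 \<or> k = 3 \<and> l = 2" using less.prems by linarith
    then show ?thesis by (auto simp: R_diff_small)
  next
    case False
    then obtain i where i: "j = Suc (Suc i)" "i \<ge> 5"
      using that[of "j - 2"] by simp
    show ?thesis using less.prems
    proof (induction k l rule: linorder_wlog)
      case (sym k l)
      then show ?case by (simp add: add.commute)
    next
      case (le k l)
      have sum: "k + l + 3 = fib (Suc i) + fib i" using le i by simp
      consider "l \<ge> fib (Suc i)" | "l < fib (Suc i)" "k < fib i" | "l < fib (Suc i)" "k \<ge> fib i"
        by linarith
      then show ?case
      proof cases
        case 1
        then obtain p where p: "l = fib (Suc i) + p" using le_Suc_ex by blast
        have pk: "p + k + 3 = fib i" using sum p by simp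
        have d: "R_diff l = R_diff p - R_diff k" unfolding p by (rule R_diff_reflection[OF pk])
        show ?thesis
        proof (cases "p \<ge> 2")
          case True
          have "sgn (R_diff p) = - sgn (R_diff k)"
            by (rule less.IH[OF _ pk True]) (use i le in auto)
          then show ?thesis using d by (auto simp: sgn_if split: if_splits)
        next
          case False
          then have "R_diff p = 0" by (simp add: R_diff_less_2)
          then show ?thesis using d by (simp add: sgn_if)
        qed
      next
        case 2
        then have "Suc l = fib (Suc i) \<and> k + 2 = fib i \<or> l + 2 = fib (Suc i) \<and> Suc k = fib i"
          using sum by linarith
        then show ?thesis
          using R_diff_pred_fib[of l "Suc i"] R_diff_fib_minus_2[of k i]
            R_diff_pred_fib[of k i] R_diff_fib_minus_2[of l "Suc i"] i by auto
      next
        case 3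
        obtain h where h: "i = Suc h" using i by (cases i) auto
        obtain p where p: "k = fib i + p" using 3 le_Suc_ex by blast
        obtain q where q: "l = fib i + q" using that[of "l - fib i"] 3 le by simp
        have pq: "p + q + 3 = fib h" using sum p q h by simp
        have "q + p + 3 = fib h" using pq by simp
        then have "R_diff k = R_diff p - R_diff q" "R_diff l = R_diff q - R_diff p"
          unfolding p q h using pq by (simp_all only: R_diff_reflection)
        then have "R_diff k = - R_diff l" by simp
        then show ?thesis by (simp add: sgn_if)
      qed
    qed
  qed
qed

text \<open>
  In \<open>d (fib (Suc j) + k) = d k - d l\<close> the two terms on the right cannot cancel: either
  they add up with the same sign, or \<open>l < 2\<close> and \<open>d l = 0\<close>.
\<close>

lemma R_diff_fib_add_eq_0_iff:
  assumes "j \<ge> 5" "2 \<le> k" "k < fib j"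
  shows "R_diff (fib (Suc j) + k) = 0 \<longleftrightarrow> R_diff k = 0"
proof -
  consider "Suc k = fib j" | "k + 2 = fib j" | "k + 3 \<le> fib j" using assms by linarith
  then show ?thesis
  proof cases
    case 1
    then have "Suc (fib (Suc j) + k) = fib (Suc (Suc j))" by simp
    then show ?thesis
      using R_diff_pred_fib[OF 1] R_diff_pred_fib[of "fib (Suc j) + k" "Suc (Suc j)"] assms by simp
  next
    case 2
    then have "fib (Suc j) + k + 2 = fib (Suc (Suc j))" by simp
    then show ?thesis
      using R_diff_fib_minus_2[OF 2] R_diff_fib_minus_2[of "fib (Suc j) + k" "Suc (Suc j)"] assms
      by simp
  next
    case 3
    then obtain l where l: "k + l + 3 = fib j" using that[of "fib j - (k + 3)"] by simp
    have d: "R_diff (fib (Suc j) + k) = R_diff k - R_diff l" by (rule R_diff_reflection[OF l])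
    show ?thesis
    proof (cases "l \<ge> 2")
      case True
      then have "sgn (R_diff k) = - sgn (R_diff l)"
        by (rule R_diff_antisymmetric[OF l assms(2)])
      then show ?thesis using d by (auto simp: sgn_if split: if_splits)
    next
      case False
      then have "R_diff l = 0" by (simp add: R_diff_less_2)
      then show ?thesis using d by simp
    qed
  qed
qed

text \<open>
  Reflecting \<open>c\<close> at level \<open>j + 2\<close> leads to \<open>fib (j + 1) + l\<close>, where \<open>l\<close> is the reflection of
  \<open>c\<close> at level \<open>j\<close>; so two steps up reproduce the same value \<open>- d l\<close>. It is applied with
  \<open>c = 0\<close> and \<open>c = 1\<close>.
\<close>

lemma R_diff_fib_add_periodic:
  assumes "R_diff c = 0" "c + 3 \<le> fib j"
  shows "R_diff (fib (j + 3) + c) = R_diff (fib (j + 1) + c)"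
proof -
  obtain l where l: "c + l + 3 = fib j" using that[of "fib j - (c + 3)"] assms(2) by simp
  have "R_diff (fib (Suc (j + 2)) + c) = R_diff c - R_diff (fib (Suc j) + l)"
    by (rule R_diff_reflection) (use l in simp)
  moreover have "R_diff (fib (Suc j) + l) = R_diff l - R_diff c"
    by (rule R_diff_reflection) (use l in simp)
  moreover have "R_diff (fib (Suc j) + c) = R_diff c - R_diff l"
    by (rule R_diff_reflection[OF l])
  ultimately show ?thesis using assms(1) by (simp add: numeral_3_eq_3)
qed

text \<open>
  Both conditions depend only on the parity of \<open>m\<close>: the difference vanishes at \<open>fib m\<close> for odd
  \<open>m\<close> and at \<open>fib m + 1\<close> for even \<open>m\<close>.
\<close>

lemma R_diff_fib_xor:
  assumes "m \<ge> 5"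
  shows "R_diff (fib m) = 0 \<longleftrightarrow> R_diff (fib m + 1) \<noteq> 0"
  using assms
proof (induction m rule: less_induct)
  case (less m)
  \<comment> \<open>The periodicity needs \<open>1 + 3 \<le> fib j\<close>, so the step only reaches \<open>m = j + 3 \<ge> 8\<close>, and three
    initial values of \<open>m\<close> are computed.\<close>
  have d8: "R_diff 8 = -1" using R_diff_reflection[of 0 2 5] by (simp add: fib_small R_diff_small)
  have d9: "R_diff 9 = 0" using R_diff_reflection[of 1 1 5] by (simp add: fib_small R_diff_small)
  have d13: "R_diff 13 = 0" using R_diff_reflection[of 0 5 6] by (simp add: fib_small R_diff_small)
  have d14: "R_diff 14 = -1" using R_diff_reflection[of 1 4 6] by (simp add: fib_small R_diff_small)
  show ?case
  proof (cases "m \<ge> 8")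
    case True
    then obtain j where j: "m = j + 3" "j \<ge> 5" using that[of "m - 3"] by simp
    have "fib j \<ge> 5" using fib_mono[OF j(2)] by (simp add: fib_small)
    then show ?thesis
      using R_diff_fib_add_periodic[of 0 j] R_diff_fib_add_periodic[of 1 j] R_diff_small
        less.IH[of "j + 1"] j by simp
  next
    case False
    then have "m = 5 \<or> m = 6 \<or> m = 7" using less.prems by auto
    then show ?thesis using d8 d9 d13 d14 R_diff_small by (auto simp: fib_small)
  qed
qed

section \<open>Counting\<close>

definition R_eq_count :: "nat \<Rightarrow> nat"
  where "R_eq_count N = card {n. n < N \<and> R n = R (n + 1)}"

lemma R_eq_count_0: "R_eq_count 0 = 0"
  by (simp add: R_eq_count_def)

lemma R_eq_count_Suc: "R_eq_count (Suc N) = R_eq_count N + of_bool (R_diff N = 0)"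
proof -
  have "{n. n < Suc N \<and> R n = R (n + 1)} =
      {n. n < N \<and> R n = R (n + 1)} \<union> (if R_diff N = 0 then {N} else {})"
    by (auto simp: less_Suc_eq R_diff_eq_0_iff)
  then show ?thesis by (simp add: R_eq_count_def card_insert_if)
qed

lemma R_eq_count_le: "R_eq_count N \<le> N"
  by (induction N) (auto simp: R_eq_count_0 R_eq_count_Suc)

text \<open>
  The 1 on the left makes up for the two smallest positions, which are both zeros in
  \<open>{0, 1}\<close> but of which only one survives the shift by \<open>fib (Suc j)\<close>.
\<close>

lemma R_eq_count_fib_add:
  assumes m: "j \<ge> 5" and "2 \<le> N" "N \<le> fib j"
  shows "R_eq_count (fib (Suc j) + N) + 1 = R_eq_count (fib (Suc j)) + R_eq_count N"
  using assms(2,3)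
proof (induction N rule: dec_induct)
  case base
  then show ?case
    using R_diff_fib_xor[of "Suc j"] m
    by (auto simp: R_eq_count_0 R_eq_count_Suc R_diff_small numeral_2_eq_2)
next
  case (step N)
  then show ?case
    using R_diff_fib_add_eq_0_iff[OF m, of N] by (simp add: R_eq_count_Suc)
qed

lemma R_eq_count_fib: "R_eq_count (fib (j + 5)) = fib (j + 2) + 1"
proof (induction j rule: fib.induct)
  case 1
  have "R_eq_count 5 = 2"
    using R_diff_small by (simp add: eval_nat_numeral R_eq_count_Suc R_eq_count_0)
  then show ?case by (simp add: fib_small)
next
  case 2
  have "R_eq_count 8 = 3"
    using R_diff_small by (simp add: eval_nat_numeral R_eq_count_Suc R_eq_count_0)
  then show ?case by (simp add: fib_small numeral_eq_Suc)
next
  case (3 j)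
  have "2 \<le> fib (j + 5)" using fib_mono[of 3 "j + 5"] by (simp add: fib_small)
  then have "R_eq_count (fib (Suc (j + 5)) + fib (j + 5)) + 1
      = R_eq_count (fib (Suc (j + 5))) + R_eq_count (fib (j + 5))"
    by (intro R_eq_count_fib_add) auto
  moreover have "fib (Suc (Suc j) + 5) = fib (Suc (j + 5)) + fib (j + 5)"
    using fib.simps(3)[of "j + 5"] by (simp only: add_Suc)
  ultimately show ?case using 3 by simp
qed

section \<open>The discrepancy\<close>

lemma golden_ratio_square: "\<phi> ^ 2 = \<phi> + 1"
  by (simp add: golden_ratio_def power2_eq_square field_simps)

lemma golden_ratio_gt_1: "\<phi> > 1"
  by (simp add: golden_ratio_def)

lemma golden_ratio_cube: "\<phi> ^ 3 = 2 * \<phi> + 1"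
  using golden_ratio_square by (simp add: power3_eq_cube power2_eq_square algebra_simps)

text \<open>
  Passing from \<open>n\<close> to \<open>n + 1\<close> multiplies \<open>\<phi> * fib n - fib (n + 1)\<close> by \<open>1 - \<phi>\<close>, which has
  modulus less than 1.
\<close>

lemma golden_ratio_fib_dist: "\<bar>\<phi> * fib n - fib (Suc n)\<bar> \<le> 1"
proof (induction n)
  case 0
  show ?case by simp
next
  case (Suc n)
  have "\<phi> * fib (Suc n) - fib (Suc (Suc n)) = - ((\<phi> - 1) * (\<phi> * fib n - fib (Suc n)))"
  proof -
    have "\<phi> * (\<phi> * fib n) = \<phi> * fib n + fib n"
      using golden_ratio_square by (metis distrib_right mult.assoc mult_1 power2_eq_square)
    then show ?thesis by (simp add: algebra_simps)
  qed
  then have "\<bar>\<phi> * fib (Suc n) - fib (Suc (Suc n))\<bar> = (\<phi> - 1) * \<bar>\<phi> * fib n - fib (Suc n)\<bar>"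
    using golden_ratio_gt_1 by (simp add: abs_mult)
  also have "\<dots> \<le> 1 * 1"
  proof (rule mult_mono)
    have "sqrt 5 \<le> 3" by (rule real_le_lsqrt) auto
    then show "\<phi> - 1 \<le> 1" by (simp add: golden_ratio_def)
  qed (use Suc in auto)
  finally show ?case by simp
qed

definition discrepancy :: "nat \<Rightarrow> real"
  where "discrepancy N = R_eq_count N - N / \<phi> ^ 3"

text \<open>
  Here \<open>fib (j + 5) = 2 * fib (j + 3) + fib (j + 2)\<close> and \<open>\<phi> ^ 3 = 2 * \<phi> + 1\<close>, so
  \<open>fib (j + 5)\<close> and \<open>\<phi> ^ 3 * fib (j + 2)\<close> differ by twice the bounded quantity of
  \<open>golden_ratio_fib_dist\<close>.
\<close>

lemma discrepancy_fib: "\<bar>discrepancy (fib (j + 5))\<bar> \<le> 2"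
proof -
  define x where "x = \<phi> * fib (j + 2) - fib (Suc (j + 2))"
  have fib: "real (fib (j + 5)) = 2 * fib (Suc (j + 2)) + fib (j + 2)"
    by (simp add: numeral_eq_Suc)
  have "discrepancy (fib (j + 5)) * \<phi> ^ 3
      = (fib (j + 2) + 1) * \<phi> ^ 3 - (2 * fib (Suc (j + 2)) + fib (j + 2))"
    using golden_ratio_gt_1 unfolding discrepancy_def R_eq_count_fib fib
    by (simp add: left_diff_distrib)
  also have "\<dots> = \<phi> ^ 3 + 2 * x"
    by (simp add: golden_ratio_cube x_def algebra_simps)
  finally have "discrepancy (fib (j + 5)) = 1 + 2 * x / \<phi> ^ 3"
    using golden_ratio_gt_1 by (simp add: divide_simps)
  moreover have "\<bar>2 * x / \<phi> ^ 3\<bar> \<le> 1"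
  proof -
    have "\<bar>x\<bar> \<le> 1" unfolding x_def by (rule golden_ratio_fib_dist)
    then have "\<bar>2 * x\<bar> \<le> \<phi> ^ 3" using golden_ratio_gt_1 golden_ratio_cube by linarith
    then show ?thesis using golden_ratio_gt_1 by (simp add: divide_simps)
  qed
  ultimately show ?thesis by linarith
qed

lemma discrepancy_fib_add:
  assumes "j \<ge> 5" "N \<le> fib j"
  shows "\<bar>discrepancy (fib (Suc j) + N) - discrepancy (fib (Suc j)) - discrepancy N\<bar> \<le> 1"
proof -
  have "discrepancy (fib (Suc j) + N) - discrepancy (fib (Suc j)) - discrepancy N
      = real (R_eq_count (fib (Suc j) + N)) - R_eq_count (fib (Suc j)) - R_eq_count N"
    by (simp add: discrepancy_def add_divide_distrib)
  moreover have "\<bar>\<dots>\<bar> \<le> 1"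
  proof (cases "N \<ge> 2")
    case True
    have "real (R_eq_count (fib (Suc j) + N)) + 1 = R_eq_count (fib (Suc j)) + R_eq_count N"
      using R_eq_count_fib_add[OF assms(1) True assms(2)] by linarith
    then show ?thesis by linarith
  next
    case False
    then have "N = 0 \<or> N = Suc 0" by auto
    then show ?thesis by (auto simp: R_eq_count_0 R_eq_count_Suc R_diff_small)
  qed
  ultimately show ?thesis by linarith
qed

text \<open>
  Removing the largest Fibonacci number from \<open>N\<close> costs at most 3 (by \<open>discrepancy_fib\<close> and
  \<open>discrepancy_fib_add\<close>) and leaves a number \<open>k \<le> N / 2\<close>, which lowers \<open>log 2\<close> by at least 1.
  The constant 8 covers the range \<open>N < 8\<close>, where the additivity is not available.
\<close>

lemma discrepancy_bound: "N \<ge> 1 \<Longrightarrow> \<bar>discrepancy N\<bar> \<le> 8 + 3 * log 2 N"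
proof (induction N rule: less_induct)
  case (less N)
  show ?case
  proof (cases "N < 8")
    case True
    have "\<bar>discrepancy N\<bar> \<le> N"
    proof -
      have "N / \<phi> ^ 3 \<le> N" using golden_ratio_gt_1 by (simp add: divide_le_eq mult_le_cancel_left1)
      moreover have "0 \<le> N / \<phi> ^ 3" using golden_ratio_gt_1 by simp
      moreover have "real (R_eq_count N) \<le> N" using R_eq_count_le by simp
      ultimately show ?thesis unfolding discrepancy_def by linarith
    qed
    moreover have "log 2 N \<ge> 0" using less.prems by simp
    ultimately show ?thesis using True by linarith
  next
    case False
    define m where "m = (LEAST m. N < fib m)"
    have "N < fib (N + 2)" by (rule less_fib_add_2)
    then have m: "N < fib m" unfolding m_def by (rule LeastI)
    have m_min: "fib i \<le> N" if "i < m" for i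
      using not_less_Least[of i "\<lambda>m. N < fib m"] that unfolding m_def by auto
    have "m > 6"
    proof (rule ccontr)
      assume "\<not> m > 6"
      then have "fib m \<le> fib 6" by (intro fib_mono) simp
      then show False using m False by (simp add: fib_small)
    qed
    then obtain j where j: "m = Suc (Suc j)" "j \<ge> 5" using that[of "m - 2"] by simp
    obtain k where k: "N = fib (Suc j) + k" using m_min[of "Suc j"] j le_Suc_ex by auto
    have kj: "k < fib j" using m k j by simp
    obtain i where i: "Suc j = i + 5" using that[of "j - 4"] j by simp
    have D: "\<bar>discrepancy N\<bar> \<le> \<bar>discrepancy k\<bar> + 3"
      using discrepancy_fib_add[of j k] kj j discrepancy_fib[of i] k i by simp
    show ?thesis
    proof (cases "k = 0")
      case True
      have "log 2 N \<ge> 0" using less.prems by simp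
      then show ?thesis using D True by (simp add: discrepancy_def R_eq_count_0)
    next
      case False
      have "2 * k \<le> N" using k kj fib_mono[of j "Suc j"] by simp
      have "\<bar>discrepancy k\<bar> \<le> 8 + 3 * log 2 k"
        by (rule less.IH) (use False \<open>2 * k \<le> N\<close> in auto)
      moreover have "log 2 k + 1 = log 2 (2 * k)" using False by (simp add: log_mult)
      moreover have "log 2 (2 * k) \<le> log 2 N"
        using False \<open>2 * k \<le> N\<close> by (subst log_le_cancel_iff) auto
      ultimately show ?thesis using D by linarith
    qed
  qed
qed

theorem corollary1p1:
  shows "(\<lambda>N::nat. real (card {n. n < N \<and> R n = R (n + 1)}) / real N)
           \<longlonglongrightarrow> 1 / \<phi> ^ 4 + 1 / \<phi> ^ 5
         \<and> 1 / \<phi> ^ 4 + 1 / \<phi> ^ 5 = 1 / \<phi> ^ 3"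
proof -
  have eq: "1 / \<phi> ^ 4 + 1 / \<phi> ^ 5 = 1 / \<phi> ^ 3"
  proof -
    have "1 / \<phi> ^ 4 + 1 / \<phi> ^ 5 = (\<phi> + 1) / \<phi> ^ 5"
      using golden_ratio_gt_1 by (simp add: divide_simps eval_nat_numeral)
    also have "\<dots> = 1 / \<phi> ^ 3"
      using golden_ratio_gt_1 by (simp add: golden_ratio_square[symmetric] divide_simps eval_nat_numeral)
    finally show ?thesis .
  qed
  have "(\<lambda>N. discrepancy N / N) \<longlonglongrightarrow> 0"
  proof (rule Lim_null_comparison)
    show "\<forall>\<^sub>F N in sequentially. norm (discrepancy N / N) \<le> (8 + 3 * log 2 N) / N"
      using eventually_ge_at_top[of 1]
      by eventually_elim (use discrepancy_bound in \<open>auto simp: divide_right_mono\<close>)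
    show "(\<lambda>N::nat. (8 + 3 * log 2 N) / N) \<longlonglongrightarrow> 0" by real_asymp
  qed
  then have "(\<lambda>N. discrepancy N / N + 1 / \<phi> ^ 3) \<longlonglongrightarrow> 0 + 1 / \<phi> ^ 3"
    by (intro tendsto_intros)
  moreover have "\<forall>\<^sub>F N in sequentially. discrepancy N / N + 1 / \<phi> ^ 3
      = real (card {n. n < N \<and> R n = R (n + 1)}) / real N"
    using eventually_gt_at_top[of 0]
    by eventually_elim (simp add: discrepancy_def R_eq_count_def diff_divide_distrib)
  ultimately have "(\<lambda>N::nat. real (card {n. n < N \<and> R n = R (n + 1)}) / real N)
      \<longlonglongrightarrow> 0 + 1 / \<phi> ^ 3"
    by (rule Lim_transform_eventually)
  then show ?thesis using eq by simp
qed

end
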